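(* Type checking in the theory Glob is decidable: for every raw context $\Gamma$ the type $\Gamma\vdash$ is decidable; for all raw contexts $\Delta,\Gamma$ and raw substitution $\gamma$ the type $\Delta\vdash\gamma:\Gamma$ is decidable; for every raw context $\Gamma$ and raw type $A$ the type $\Gamma\vdash A$ is decidable; and for every raw context $\Gamma$, raw type $A$ and raw term $t$ the type $\Gamma\vdash t:A$ is decidable. Here a type $X$ is decidable if one can construct an element of $X+\neg X$.
   Context: Meta-theory: Martin-Löf type theory without axiom K. Raw syntax of Glob: raw types $*$ and $\Rightarrow(A,t,u)$; raw terms $\mathrm{Var}\,x$, $x\in\mathbb{N}$; raw contexts are finite lists of pairs $(x,A)$; raw substitutions finite lists of pairs $(x,t)$; $\mathrm{nil}$ empty list, $L::p$ appends $p$. Action of substitutions: $*[\gamma]=*$, $\Rightarrow(A,t,u)[\gamma]=\Rightarrow(A[\gamma],t[\gamma],u[\gamma])$, $\mathrm{Var}\,x[\mathrm{nil}]=\mathrm{Var}\,x$, $\mathrm{Var}\,x[\gamma::(v,t)]=t$ if $x=v$, else $\mathrm{Var}\,x[\gamma]$. Judgements $\Gamma\vdash$, $\Gamma\vdash A$, $\Gamma\vdash t:A$, $\Delta\vdash\gamma:\Gamma$ are inductive families of types (inhabitants are derivations) generated by: (ec) $\mathrm{nil}\vdash$; (cc) from $\Gamma\vdash$, $\Gamma\vdash A$, $x=\mathrm{length}(\Gamma)$ derive $\Gamma::(x,A)\vdash$; (ob) from $\Gamma\vdash$ derive $\Gamma\vdash *$; (ar) from $\Gamma\vdash t:A$,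 $\Gamma\vdash u:A$ derive $\Gamma\vdash\Rightarrow(A,t,u)$; (var) from $\Gamma\vdash$ and a proof that $(x,A)$ is an element of $\Gamma$ derive $\Gamma\vdash\mathrm{Var}\,x:A$; (es) from $\Delta\vdash$ derive $\Delta\vdash\mathrm{nil}:\mathrm{nil}$; (sc) from $\Delta\vdash\gamma:\Gamma$, $\Gamma::(x,A)\vdash$, $\Delta\vdash t:A[\gamma]$, $x=y$ derive $\Delta\vdash\gamma::(y,t):\Gamma::(x,A)$. *)

theory Defs
  imports Main "HOL-Library.Nat_Bijection"
begin

section \<open>Raw syntax\<close>

datatype rtm = Var nat

datatype rty = Star | Arr rty rtm rtm

text \<open>Contexts and substitutions grow at the end. They are represented by HOL lists whose
  head is the entry added last, so that appending an entry is \<open>Cons\<close>.\<close>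

type_synonym rctx = "(nat \<times> rty) list"
type_synonym rsub = "(nat \<times> rtm) list"

abbreviation snoc :: "'a list \<Rightarrow> 'a \<Rightarrow> 'a list"  (infixl "\<lhd>" 66)
  where "L \<lhd> p \<equiv> p # L"

primrec lookup :: "nat \<Rightarrow> rsub \<Rightarrow> rtm" where
  "lookup x [] = Var x"
| "lookup x (\<gamma> \<lhd> p) = (if x = fst p then snd p else lookup x \<gamma>)"

primrec subst_tm :: "rtm \<Rightarrow> rsub \<Rightarrow> rtm" where
  "subst_tm (Var x) \<gamma> = lookup x \<gamma>"

primrec subst_ty :: "rty \<Rightarrow> rsub \<Rightarrow> rty" where
  "subst_ty Star \<gamma> = Star"
| "subst_ty (Arr A t u) \<gamma> = Arr (subst_ty A \<gamma>) (subst_tm t \<gamma>) (subst_tm u \<gamma>)"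


section \<open>Judgements and their derivations\<close>

text \<open>The judgements are families of types whose inhabitants are derivations. A family is
  rendered by a datatype of derivation trees together with an inductive predicate relating
  a judgement to its derivations. In every rule all raw expressions are determined by the
  conclusion, so a tree records only the derivations of the premises and, for \<open>VAR\<close>, the
  position witnessing that an entry is an element of the context; equality proofs between
  natural numbers are unique and are not recorded.\<close>

datatype cder = EC | CC cder tder
     and tder = OB cder | AR mder mder
     and mder = VAR cder nat

datatype sder = ES cder | SC sder cder mder

inductive ctx_der :: "rctx \<Rightarrow> cder \<Rightarrow> bool"
      and ty_der :: "rctx \<Rightarrow> rty \<Rightarrow> tder \<Rightarrow> bool"
      and tm_der :: "rctx \<Rightarrow> rtm \<Rightarrow> rty \<Rightarrow> mder \<Rightarrow> bool"
where
  ec: "ctx_der [] EC"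
| cc: "\<lbrakk>ctx_der \<Gamma> c; ty_der \<Gamma> A a; x = length \<Gamma>\<rbrakk> \<Longrightarrow> ctx_der (\<Gamma> \<lhd> (x, A)) (CC c a)"
| ob: "ctx_der \<Gamma> c \<Longrightarrow> ty_der \<Gamma> Star (OB c)"
| ar: "\<lbrakk>tm_der \<Gamma> t A d; tm_der \<Gamma> u A e\<rbrakk> \<Longrightarrow> ty_der \<Gamma> (Arr A t u) (AR d e)"
| var: "\<lbrakk>ctx_der \<Gamma> c; n < length \<Gamma>; \<Gamma> ! n = (x, A)\<rbrakk> \<Longrightarrow> tm_der \<Gamma> (Var x) A (VAR c n)"

inductive sub_der :: "rctx \<Rightarrow> rsub \<Rightarrow> rctx \<Rightarrow> sder \<Rightarrow> bool"
where
  es: "ctx_der \<Delta> c \<Longrightarrow> sub_der \<Delta> [] [] (ES c)"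
| sc: "\<lbrakk>sub_der \<Delta> \<gamma> \<Gamma> s; ctx_der (\<Gamma> \<lhd> (x, A)) c; tm_der \<Delta> t (subst_ty A \<gamma>) d; x = y\<rbrakk>
       \<Longrightarrow> sub_der \<Delta> (\<gamma> \<lhd> (y, t)) (\<Gamma> \<lhd> (x, A)) (SC s c d)"


section \<open>Recursive functions\<close>

text \<open>The total recursive functions: the least class containing the zero, successor and
  projection functions and closed under composition, primitive recursion and minimisation
  of regular functions. In \<open>recursive n f\<close> only the values of \<open>f\<close> on lists of length \<open>n\<close>
  are meaningful.\<close>

inductive recursive :: "nat \<Rightarrow> (nat list \<Rightarrow> nat) \<Rightarrow> bool" where
  zero: "recursive n (\<lambda>xs. 0)"
| succ: "recursive 1 (\<lambda>xs. Suc (xs ! 0))"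
| proj: "i < n \<Longrightarrow> recursive n (\<lambda>xs. xs ! i)"
| comp: "\<lbrakk>recursive (length gs) f; \<forall>g\<in>set gs. recursive n g\<rbrakk>
         \<Longrightarrow> recursive n (\<lambda>xs. f (map (\<lambda>g. g xs) gs))"
| prec: "\<lbrakk>recursive n f; recursive (n + 2) g\<rbrakk>
         \<Longrightarrow> recursive (n + 1)
               (\<lambda>xs. rec_nat (f (tl xs)) (\<lambda>k r. g (k # r # tl xs)) (hd xs))"
| minim: "\<lbrakk>recursive (n + 1) f; \<forall>xs. length xs = n \<longrightarrow> (\<exists>y. f (y # xs) = 0)\<rbrakk>
         \<Longrightarrow> recursive n (\<lambda>xs. LEAST y. f (y # xs) = 0)"

definition computable :: "('a \<Rightarrow> nat) \<Rightarrow> ('b \<Rightarrow> nat) \<Rightarrow> ('a \<Rightarrow> 'b) \<Rightarrow> bool" where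
  "computable enc enc' h \<longleftrightarrow> (\<exists>f. recursive 1 f \<and> (\<forall>a. f [enc a] = enc' (h a)))"

primrec enc_option :: "('a \<Rightarrow> nat) \<Rightarrow> 'a option \<Rightarrow> nat" where
  "enc_option enc None = 0"
| "enc_option enc (Some d) = Suc (enc d)"

text \<open>In type theory, decidability of a family \<open>X\<close> is a function assigning to every index
  \<open>i\<close> an element of \<open>X i + \<not> X i\<close>. In classical logic the existence of such a function is
  trivial, so its computability is required explicitly. An element of the left summand is
  \<open>Some d\<close> with \<open>d\<close> an inhabitant of \<open>X i\<close>; an element of the right summand carries no data
  and is \<open>None\<close>.\<close>

definition decidable_family ::
    "('i \<Rightarrow> nat) \<Rightarrow> ('d \<Rightarrow> nat) \<Rightarrow> ('i \<Rightarrow> 'd \<Rightarrow> bool) \<Rightarrow> bool" where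
  "decidable_family enc enc' X \<longleftrightarrow>
     (\<exists>\<delta>. computable enc (enc_option enc') \<delta> \<and>
          (\<forall>i. case \<delta> i of Some d \<Rightarrow> X i d | None \<Rightarrow> \<not> (\<exists>d. X i d)))"


section \<open>Numbering of raw syntax and derivations\<close>

definition enc_prod :: "('a \<Rightarrow> nat) \<Rightarrow> ('b \<Rightarrow> nat) \<Rightarrow> 'a \<times> 'b \<Rightarrow> nat" where
  "enc_prod e e' p = prod_encode (e (fst p), e' (snd p))"

definition enc_list :: "('a \<Rightarrow> nat) \<Rightarrow> 'a list \<Rightarrow> nat" where
  "enc_list e xs = list_encode (map e xs)"

primrec enc_tm :: "rtm \<Rightarrow> nat" where
  "enc_tm (Var x) = x"

primrec enc_ty :: "rty \<Rightarrow> nat" where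
  "enc_ty Star = 0"
| "enc_ty (Arr A t u) = Suc (prod_encode (enc_ty A, prod_encode (enc_tm t, enc_tm u)))"

definition enc_ctx :: "rctx \<Rightarrow> nat" where
  "enc_ctx = enc_list (enc_prod id enc_ty)"

definition enc_sub :: "rsub \<Rightarrow> nat" where
  "enc_sub = enc_list (enc_prod id enc_tm)"

primrec enc_cder :: "cder \<Rightarrow> nat"
    and enc_tder :: "tder \<Rightarrow> nat"
    and enc_mder :: "mder \<Rightarrow> nat" where
  "enc_cder EC = 0"
| "enc_cder (CC c a) = Suc (prod_encode (enc_cder c, enc_tder a))"
| "enc_tder (OB c) = sum_encode (Inl (enc_cder c))"
| "enc_tder (AR d e) = sum_encode (Inr (prod_encode (enc_mder d, enc_mder e)))"
| "enc_mder (VAR c n) = prod_encode (enc_cder c, n)"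

primrec enc_sder :: "sder \<Rightarrow> nat" where
  "enc_sder (ES c) = sum_encode (Inl (enc_cder c))"
| "enc_sder (SC s c d) =
     sum_encode (Inr (prod_encode (enc_sder s, prod_encode (enc_cder c, enc_mder d))))"

lemma inj_enc_tm: "inj enc_tm"
proof (rule injI)
  fix t u show "enc_tm t = enc_tm u \<Longrightarrow> t = u" by (cases t; cases u) simp
qed

lemma inj_enc_ty: "inj enc_ty"
proof (rule injI)
  fix A B show "enc_ty A = enc_ty B \<Longrightarrow> A = B"
  proof (induction A arbitrary: B)
    case Star then show ?case by (cases B) auto
  next
    case (Arr A t u) then show ?case
      by (cases B) (auto simp: prod_encode_eq dest: injD[OF inj_enc_tm])
  qed
qed

lemma inj_enc_prod: "inj e \<Longrightarrow> inj e' \<Longrightarrow> inj (enc_prod e e')"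
  by (auto simp: inj_def enc_prod_def prod_encode_eq)

lemma inj_enc_list: "inj e \<Longrightarrow> inj (enc_list e)"
  by (auto simp: inj_def enc_list_def list_encode_eq inj_map_eq_map)

lemma inj_enc_ctx: "inj enc_ctx"
  by (simp add: enc_ctx_def inj_enc_list inj_enc_prod inj_enc_ty)

lemma inj_enc_sub: "inj enc_sub"
  by (simp add: enc_sub_def inj_enc_list inj_enc_prod inj_enc_tm)

lemma enc_der_eq:
  "enc_cder c = enc_cder c' \<Longrightarrow> c = c'"
  "enc_tder a = enc_tder a' \<Longrightarrow> a = a'"
  "enc_mder d = enc_mder d' \<Longrightarrow> d = d'"
proof (induction c and a and d arbitrary: c' and a' and d')
  case EC then show ?case by (cases c') auto
next
  case (CC c a) then show ?case by (cases c') (auto simp: prod_encode_eq)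
next
  case (OB c) then show ?case by (cases a') (auto simp: sum_encode_eq)
next
  case (AR d e) then show ?case by (cases a') (auto simp: sum_encode_eq prod_encode_eq)
next
  case (VAR c n) then show ?case by (cases d') (auto simp: prod_encode_eq)
qed

lemma enc_sder_eq: "enc_sder s = enc_sder s' \<Longrightarrow> s = s'"
proof (induction s arbitrary: s')
  case (ES c) then show ?case by (cases s') (auto simp: sum_encode_eq dest: enc_der_eq)
next
  case (SC s c d) then show ?case
    by (cases s') (auto simp: sum_encode_eq prod_encode_eq dest: enc_der_eq)
qed

end

theory Submission
  imports Defs
begin

text \<open>A variable has type \<open>A\<close> exactly when it is paired with \<open>A\<close> in the context, and the premises
  of an arrow type only mention its two end points, so checking types and terms amounts to
  searching the context, while contexts and substitutions are checked by recursion along the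
  lists. Every recursion involved, including substitution and lookup, makes a single recursive
  call on an argument with a smaller code. Such a recursion reduces to primitive recursion along
  the orbit of the descent map, which makes the checkers recursive functions on codes.\<close>

section \<open>Closure properties of recursive functions\<close>

text \<open>Only values on lists of length \<open>n\<close> carry meaning, so membership is closed
  under agreement on such lists. This allows bodies to be rewritten freely.\<close>

definition rec_fun :: "nat \<Rightarrow> (nat list \<Rightarrow> nat) \<Rightarrow> bool" where
  "rec_fun n f \<longleftrightarrow> (\<exists>g. recursive n g \<and> (\<forall>xs. length xs = n \<longrightarrow> g xs = f xs))"

lemma rec_fun_cong:
  "rec_fun n f \<Longrightarrow> (\<And>xs. length xs = n \<Longrightarrow> f xs = g xs) \<Longrightarrow> rec_fun n g"
  unfolding rec_fun_def by auto

lemma rec_fun_zero: "rec_fun n (\<lambda>xs. 0)"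
  unfolding rec_fun_def using recursive.zero by blast

lemma rec_fun_proj: "i < n \<Longrightarrow> rec_fun n (\<lambda>xs. xs ! i)"
  unfolding rec_fun_def using recursive.proj by blast

lemma rec_fun_comp:
  assumes "rec_fun (length gs) f" "\<forall>g\<in>set gs. rec_fun n g"
  shows "rec_fun n (\<lambda>xs. f (map (\<lambda>g. g xs) gs))"
proof -
  obtain f' where f': "recursive (length gs) f'" "\<And>xs. length xs = length gs \<Longrightarrow> f' xs = f xs"
    using assms(1) unfolding rec_fun_def by blast
  obtain r where r: "\<forall>g\<in>set gs. recursive n (r g) \<and> (\<forall>xs. length xs = n \<longrightarrow> r g xs = g xs)"
    using assms(2) unfolding rec_fun_def by metis
  have "recursive n (\<lambda>xs. f' (map (\<lambda>g. g xs) (map r gs)))"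
    using f'(1) r by (intro recursive.comp) auto
  moreover have "f' (map (\<lambda>g. g xs) (map r gs)) = f (map (\<lambda>g. g xs) gs)" if "length xs = n" for xs
  proof -
    have "map (\<lambda>g. g xs) (map r gs) = map (\<lambda>g. g xs) gs"
      using r that by simp
    then show ?thesis using f'(2) by (metis length_map)
  qed
  ultimately show ?thesis unfolding rec_fun_def by blast
qed

lemma rec_fun_comp1:
  assumes "rec_fun 1 f" "rec_fun n g"
  shows "rec_fun n (\<lambda>xs. f [g xs])"
  using rec_fun_comp[of "[g]" f n] assms by simp

text \<open>Composition with projections permits arguments to be permuted, repeated or
  dropped.\<close>

lemma rec_fun_select:
  assumes "rec_fun (length is) f" "set is \<subseteq> {..<n}"
  shows "rec_fun n (\<lambda>xs. f (map ((!) xs) is))"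
proof -
  have "rec_fun n (\<lambda>xs. f (map (\<lambda>g. g xs) (map (\<lambda>i xs. xs ! i) is)))"
    using assms by (intro rec_fun_comp) (auto intro: rec_fun_proj)
  then show ?thesis by (simp add: comp_def)
qed

text \<open>The two dummy arguments are the counter and the accumulator that a recursion step
  receives in front of its parameters.\<close>

lemma rec_fun_drop2:
  assumes "rec_fun n f"
  shows "rec_fun (n + 2) (\<lambda>xs. f (tl (tl xs)))"
proof (rule rec_fun_cong)
  show "rec_fun (n + 2) (\<lambda>xs. f (map ((!) xs) [2..<n + 2]))"
    using assms by (intro rec_fun_select) (auto simp del: upt_Suc)
next
  fix xs :: "nat list" assume "length xs = n + 2"
  then have "map ((!) xs) [2..<n + 2] = tl (tl xs)"
    by (intro nth_equalityI) (simp_all add: nth_tl del: upt_Suc)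
  then show "f (map ((!) xs) [2..<n + 2]) = f (tl (tl xs))" by simp
qed

lemma rec_fun_Suc:
  assumes "rec_fun n f"
  shows "rec_fun n (\<lambda>xs. Suc (f xs))"
proof -
  have "rec_fun 1 (\<lambda>xs. Suc (xs ! 0))"
    unfolding rec_fun_def using recursive.succ by blast
  from rec_fun_comp1[OF this assms] show ?thesis by simp
qed

text \<open>The scheme \<open>prec\<close> recurses on the head of its argument list. Composing it
  with \<open>m\<close> followed by all projections lets the number of steps be any recursive
  function of the parameters.\<close>

lemma rec_fun_rec_nat:
  assumes f: "rec_fun n f" and g: "rec_fun (n + 2) g" and m: "rec_fun n m"
  shows "rec_fun n (\<lambda>xs. rec_nat (f xs) (\<lambda>k r. g (k # r # xs)) (m xs))"
proof -
  obtain f' where f': "recursive n f'" "\<And>xs. length xs = n \<Longrightarrow> f' xs = f xs"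
    using f unfolding rec_fun_def by blast
  obtain g' where g': "recursive (n + 2) g'" "\<And>xs. length xs = n + 2 \<Longrightarrow> g' xs = g xs"
    using g unfolding rec_fun_def by blast
  let ?h = "\<lambda>xs. rec_nat (f' (tl xs)) (\<lambda>k r. g' (k # r # tl xs)) (hd xs)"
  let ?gs = "m # map (\<lambda>i xs. xs ! i) [0..<n]"
  have "rec_fun (length ?gs) ?h"
    unfolding rec_fun_def using recursive.prec[OF f'(1) g'(1)] by auto
  then have "rec_fun n (\<lambda>xs. ?h (map (\<lambda>g. g xs) ?gs))"
    using m by (intro rec_fun_comp) (auto intro: rec_fun_proj)
  then show ?thesis
  proof (rule rec_fun_cong)
    fix xs :: "nat list" assume len: "length xs = n"
    then have "map (\<lambda>g. g xs) ?gs = m xs # xs"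
      by (auto simp: comp_def map_nth)
    then show "?h (map (\<lambda>g. g xs) ?gs) = rec_nat (f xs) (\<lambda>k r. g (k # r # xs)) (m xs)"
      using len f'(2) g'(2) by simp
  qed
qed

lemma rec_fun_Least:
  assumes f: "rec_fun (n + 1) f" and ex: "\<And>xs. length xs = n \<Longrightarrow> \<exists>y. f (y # xs) = 0"
  shows "rec_fun n (\<lambda>xs. LEAST y. f (y # xs) = 0)"
proof -
  obtain f' where f': "recursive (n + 1) f'" "\<And>xs. length xs = n + 1 \<Longrightarrow> f' xs = f xs"
    using f unfolding rec_fun_def by blast
  have "recursive n (\<lambda>xs. LEAST y. f' (y # xs) = 0)"
    using f' ex by (intro recursive.minim) auto
  then show ?thesis unfolding rec_fun_def using f'(2) by auto
qed

section \<open>Arithmetic and case distinction\<close>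

lemma rec_fun_add:
  assumes "rec_fun n f" "rec_fun n g"
  shows "rec_fun n (\<lambda>xs. f xs + g xs)"
proof -
  have "rec_nat a (\<lambda>k r. Suc r) b = a + b" for a b :: nat by (induction b) auto
  then show ?thesis
    using rec_fun_rec_nat[OF assms(1) rec_fun_Suc[OF rec_fun_proj, of 1] assms(2)] by simp
qed

lemma rec_fun_pred:
  assumes "rec_fun n f"
  shows "rec_fun n (\<lambda>xs. f xs - 1)"
proof -
  have "rec_nat 0 (\<lambda>k r. k) a = a - 1" for a :: nat by (cases a) auto
  then show ?thesis
    using rec_fun_rec_nat[OF rec_fun_zero rec_fun_proj[of 0] assms] by simp
qed

lemma rec_fun_diff:
  assumes "rec_fun n f" "rec_fun n g"
  shows "rec_fun n (\<lambda>xs. f xs - g xs)"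
proof -
  have "rec_nat a (\<lambda>k r. r - Suc 0) b = a - b" for a b :: nat by (induction b) auto
  then show ?thesis
    using rec_fun_rec_nat[OF assms(1) rec_fun_pred[OF rec_fun_proj, of 1] assms(2)] by simp
qed

text \<open>A recursion whose step ignores counter and accumulator returns its start value after
  zero steps and the step value after any positive number of steps.\<close>

lemma rec_fun_if_zero:
  assumes "rec_fun n c" "rec_fun n f" "rec_fun n g"
  shows "rec_fun n (\<lambda>xs. if c xs = 0 then f xs else g xs)"
proof -
  have "rec_nat a (\<lambda>k r. b) k = (if k = 0 then a else b)" for a b k :: nat
    by (cases k) auto
  then show ?thesis
    using rec_fun_rec_nat[OF assms(2) rec_fun_drop2[OF assms(3)] assms(1)] by simp
qed

lemma rec_fun_triangle:
  assumes "rec_fun n f"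
  shows "rec_fun n (\<lambda>xs. triangle (f xs))"
proof -
  have "rec_nat 0 (\<lambda>k r. r + Suc k) a = triangle a" for a :: nat by (induction a) auto
  moreover have "rec_fun (n + 2) (\<lambda>xs. xs ! 1 + Suc (xs ! 0))"
    by (intro rec_fun_add rec_fun_Suc rec_fun_proj) auto
  ultimately show ?thesis
    using rec_fun_rec_nat[OF rec_fun_zero _ assms, of "\<lambda>xs. xs ! 1 + Suc (xs ! 0)"] by simp
qed

lemma rec_fun_prod_encode:
  assumes "rec_fun n f" "rec_fun n g"
  shows "rec_fun n (\<lambda>xs. prod_encode (f xs, g xs))"
  unfolding prod_encode_def using assms
  by (simp add: rec_fun_add rec_fun_triangle)

section \<open>Inverting the pairing function\<close>

text \<open>The root \<open>s\<close> is the sum of the two components of the pair coded by \<open>z\<close>.\<close>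

definition triangle_root :: "nat \<Rightarrow> nat" where
  "triangle_root z = (LEAST s. Suc z - triangle (Suc s) = 0)"

text \<open>The code is \<open>triangle (a + b) + a\<close>, which lies at or above
  \<open>triangle (a + b)\<close> and strictly below \<open>triangle (Suc (a + b))\<close>.
  Monotonicity of \<open>triangle\<close> rules out any smaller root.\<close>

lemma triangle_root_prod_encode: "triangle_root (prod_encode (a, b)) = a + b"
  unfolding triangle_root_def
proof (rule Least_equality)
  show "Suc (prod_encode (a, b)) - triangle (Suc (a + b)) = 0"
    by (simp add: prod_encode_def)
next
  fix s assume *: "Suc (prod_encode (a, b)) - triangle (Suc s) = 0"
  have mono: "mono triangle" by (simp add: mono_iff_le_Suc)
  show "a + b \<le> s"
  proof (rule ccontr)
    assume "\<not> a + b \<le> s"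
    then have "triangle (Suc s) \<le> triangle (a + b)" using monoD[OF mono, of "Suc s" "a + b"] by simp
    with * show False by (simp add: prod_encode_def)
  qed
qed

lemma fst_prod_decode: "fst (prod_decode z) = z - triangle (triangle_root z)"
proof -
  obtain a b where "z = prod_encode (a, b)" by (metis prod_decode_inverse surj_pair)
  then show ?thesis by (simp add: triangle_root_prod_encode) (simp add: prod_encode_def)
qed

lemma snd_prod_decode: "snd (prod_decode z) = triangle_root z - fst (prod_decode z)"
proof -
  obtain a b where "z = prod_encode (a, b)" by (metis prod_decode_inverse surj_pair)
  then show ?thesis by (simp add: triangle_root_prod_encode)
qed

text \<open>This is where minimisation enters; its regularity follows because the code itself bounds
  the root.\<close>

lemma rec_fun_triangle_root:
  assumes "rec_fun n f"
  shows "rec_fun n (\<lambda>xs. triangle_root (f xs))"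
proof -
  have "rec_fun 1 (\<lambda>xs. LEAST s. (\<lambda>ys. Suc (ys ! 1) - triangle (Suc (ys ! 0))) (s # xs) = 0)"
  proof (rule rec_fun_Least)
    show "rec_fun (1 + 1) (\<lambda>ys. Suc (ys ! 1) - triangle (Suc (ys ! 0)))"
      by (intro rec_fun_diff rec_fun_triangle rec_fun_Suc rec_fun_proj) auto
  next
    fix xs :: "nat list"
    \<comment> \<open>Applied to the successor of the argument, this makes the argument itself a
      witness.\<close>
    have "k \<le> triangle k" for k by (induction k) auto
    then show "\<exists>y. Suc ((y # xs) ! 1) - triangle (Suc ((y # xs) ! 0)) = 0"
      by (intro exI[of _ "xs ! 0"]) simp
  qed
  from rec_fun_comp1[OF this assms] show ?thesis
    by (simp add: triangle_root_def)
qed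

lemma rec_fun_fst:
  "rec_fun n f \<Longrightarrow> rec_fun n (\<lambda>xs. fst (prod_decode (f xs)))"
  unfolding fst_prod_decode by (intro rec_fun_diff rec_fun_triangle rec_fun_triangle_root)

lemma rec_fun_snd:
  "rec_fun n f \<Longrightarrow> rec_fun n (\<lambda>xs. snd (prod_decode (f xs)))"
  unfolding snd_prod_decode by (intro rec_fun_diff rec_fun_triangle_root rec_fun_fst)

lemma rec_fun_const: "rec_fun n (\<lambda>xs. c)"
  by (induction c) (auto intro: rec_fun_zero rec_fun_Suc)


section \<open>Computable functions on encoded data\<close>

lemma computable_iff:
  "computable e e' h \<longleftrightarrow> (\<exists>f. rec_fun 1 f \<and> (\<forall>a. f [e a] = e' (h a)))"
  unfolding computable_def rec_fun_def by (metis One_nat_def length_Cons list.size(3))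

text \<open>Reduces computability to arithmetic on codes: the equation for \<open>f\<close> is
  required only at codes that occur as values of \<open>F\<close>.\<close>

lemma computable_by_code:
  assumes "computable e e1 F" "rec_fun 1 f" "\<And>a. f [e1 (F a)] = e' (h a)"
  shows "computable e e' h"
proof -
  obtain g where "rec_fun 1 g" "\<forall>a. g [e a] = e1 (F a)"
    using assms(1) unfolding computable_iff by blast
  then show ?thesis unfolding computable_iff
    using rec_fun_comp1[OF assms(2)] assms(3) by (intro exI[of _ "\<lambda>xs. f [g xs]"]) auto
qed

lemma computable_id: "computable e e (\<lambda>a. a)"
  unfolding computable_iff using rec_fun_proj[of 0 1] by (intro exI[of _ "\<lambda>xs. xs ! 0"]) auto

lemma computable_comp:
  assumes "computable e1 e2 F" "computable e e1 G"
  shows "computable e e2 (\<lambda>a. F (G a))"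
proof -
  obtain f where "rec_fun 1 f" "\<forall>a. f [e1 a] = e2 (F a)"
    using assms(1) unfolding computable_iff by blast
  then show ?thesis using assms(2) by (auto intro: computable_by_code)
qed

lemma computable_const: "computable e e' (\<lambda>a. c)"
  by (rule computable_by_code[OF computable_id rec_fun_const]) simp

lemma computable_code: "computable e e' F \<Longrightarrow> computable e id (\<lambda>a. e' (F a))"
  unfolding computable_iff by simp

lemma computable_pair:
  assumes "computable e e1 F" "computable e e2 G"
  shows "computable e (enc_prod e1 e2) (\<lambda>a. (F a, G a))"
proof -
  obtain f where f: "rec_fun 1 f" "\<forall>a. f [e a] = e1 (F a)"
    using assms(1) unfolding computable_iff by blast
  obtain g where g: "rec_fun 1 g" "\<forall>a. g [e a] = e2 (G a)"
    using assms(2) unfolding computable_iff by blast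
  show ?thesis
    by (rule computable_by_code[OF computable_id rec_fun_prod_encode[OF f(1) g(1)]])
      (simp add: f(2) g(2) enc_prod_def)
qed

text \<open>Since \<open>computable\<close> speaks of one argument, a binary function is treated
  through pairs; the curried conclusion fits the way it occurs in function bodies.\<close>

lemma computable_comp2:
  assumes "computable (enc_prod e1 e2) e3 (\<lambda>p. H (fst p) (snd p))"
    and "computable e e1 F" "computable e e2 G"
  shows "computable e e3 (\<lambda>a. H (F a) (G a))"
  using computable_comp[OF assms(1) computable_pair[OF assms(2,3)]] by simp

lemma computable_comp3:
  assumes "computable (enc_prod e1 (enc_prod e2 e3)) e4 (\<lambda>p. K (fst p) (fst (snd p)) (snd (snd p)))"
    and "computable e e1 F" "computable e e2 G" "computable e e3 H"
  shows "computable e e4 (\<lambda>a. K (F a) (G a) (H a))"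
  using computable_comp[OF assms(1) computable_pair[OF assms(2) computable_pair[OF assms(3,4)]]]
  by simp

lemma rec_fun_arg: "rec_fun 1 (\<lambda>xs. xs ! 0)"
  by (simp add: rec_fun_proj)

lemma computable_fst:
  assumes "computable e (enc_prod e1 e2) F"
  shows "computable e e1 (\<lambda>a. fst (F a))"
  by (rule computable_by_code[OF assms rec_fun_fst[OF rec_fun_arg]]) (simp add: enc_prod_def)

lemma computable_snd:
  assumes "computable e (enc_prod e1 e2) F"
  shows "computable e e2 (\<lambda>a. snd (F a))"
  by (rule computable_by_code[OF assms rec_fun_snd[OF rec_fun_arg]]) (simp add: enc_prod_def)

lemma computable_by_code2:
  assumes "computable e e1 F" "computable e e2 G" "rec_fun 1 f"
    and "\<And>a. f [prod_encode (e1 (F a), e2 (G a))] = e' (h a)"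
  shows "computable e e' h"
  by (rule computable_by_code[OF computable_pair[OF assms(1,2)] assms(3)])
    (simp add: enc_prod_def assms(4))

section \<open>Tests and Boolean connectives\<close>

lemma computable_if:
  assumes "computable e of_bool P" "computable e e' F" "computable e e' G"
  shows "computable e e' (\<lambda>a. if P a then F a else G a)"
proof -
  \<comment> \<open>The truth value \<open>False\<close> has code zero, so the zero branch selects
    the value of \<open>G\<close>.\<close>
  have "rec_fun 1 (\<lambda>xs. if fst (prod_decode (xs ! 0)) = 0
      then snd (prod_decode (snd (prod_decode (xs ! 0))))
      else fst (prod_decode (snd (prod_decode (xs ! 0)))))"
    by (intro rec_fun_if_zero rec_fun_fst rec_fun_snd rec_fun_arg)
  then show ?thesis
    by (rule computable_by_code2[OF assms(1) computable_pair[OF assms(2,3)]])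
      (simp add: enc_prod_def)
qed

lemma computable_Not:
  assumes "computable e of_bool P"
  shows "computable e of_bool (\<lambda>a. \<not> P a)"
proof -
  have "computable e of_bool (\<lambda>a. if P a then False else True)"
    by (intro computable_if assms computable_const)
  moreover have "(if P a then False else True) = (\<not> P a)" for a by simp
  ultimately show ?thesis by (simp only:)
qed

lemma computable_conj:
  assumes "computable e of_bool P" "computable e of_bool Q"
  shows "computable e of_bool (\<lambda>a. P a \<and> Q a)"
proof -
  have "computable e of_bool (\<lambda>a. if P a then Q a else False)"
    by (intro computable_if assms computable_const)
  moreover have "(if P a then Q a else False) = (P a \<and> Q a)" for a by simp
  ultimately show ?thesis by (simp only:)
qed

lemma computable_disj:
  assumes "computable e of_bool P" "computable e of_bool Q"
  shows "computable e of_bool (\<lambda>a. P a \<or> Q a)"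
  using computable_Not[OF computable_conj[OF computable_Not[OF assms(1)] computable_Not[OF assms(2)]]]
  by simp

text \<open>Injectivity turns equality of values into equality of codes, and two numbers agree
  exactly when both truncated differences vanish.\<close>

lemma computable_eq:
  assumes "computable e e' F" "computable e e' G" "inj e'"
  shows "computable e of_bool (\<lambda>a. F a = G a)"
proof -
  have "rec_fun 1 (\<lambda>xs. 1 - ((fst (prod_decode (xs ! 0)) - snd (prod_decode (xs ! 0)))
      + (snd (prod_decode (xs ! 0)) - fst (prod_decode (xs ! 0)))))"
    by (intro rec_fun_diff rec_fun_add rec_fun_const rec_fun_fst rec_fun_snd rec_fun_arg)
  then show ?thesis
  proof (rule computable_by_code2[OF assms(1,2)])
    have "1 - ((m - n) + (n - m)) = of_bool (m = n)" for m n :: nat by auto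
    from this[of "e' (F a)" "e' (G a)" for a]
    show "1 - ((fst (prod_decode ([prod_encode (e' (F a), e' (G a))] ! 0))
        - snd (prod_decode ([prod_encode (e' (F a), e' (G a))] ! 0)))
      + (snd (prod_decode ([prod_encode (e' (F a), e' (G a))] ! 0))
        - fst (prod_decode ([prod_encode (e' (F a), e' (G a))] ! 0)))) = of_bool (F a = G a)" for a
      by (simp add: inj_eq[OF assms(3)])
  qed
qed

lemmas computable_eq_nat = computable_eq[where e' = id, OF _ _ inj_on_id]

text \<open>Serves the constants \<open>[]\<close>, \<open>None\<close> and \<open>Star\<close>,
  each the unique element with code zero.\<close>

lemma computable_eq_code_zero:
  assumes "computable e e' F" "\<And>b. e' b = 0 \<longleftrightarrow> b = c"
  shows "computable e of_bool (\<lambda>a. F a = c)"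
proof -
  have "rec_fun 1 (\<lambda>xs. 1 - xs ! 0)"
    by (intro rec_fun_diff rec_fun_const rec_fun_arg)
  then show ?thesis
    by (rule computable_by_code[OF assms(1)]) (auto simp: of_bool_def assms(2)[symmetric])
qed

section \<open>Arithmetic and recursion on encoded data\<close>

lemma computable_Suc:
  assumes "computable e id F"
  shows "computable e id (\<lambda>a. Suc (F a))"
  by (rule computable_by_code[OF assms rec_fun_Suc[OF rec_fun_arg]]) simp

lemma computable_diff:
  assumes "computable e id F" "computable e id G"
  shows "computable e id (\<lambda>a. F a - G a)"
proof -
  have "rec_fun 1 (\<lambda>xs. fst (prod_decode (xs ! 0)) - snd (prod_decode (xs ! 0)))"
    by (intro rec_fun_diff rec_fun_fst rec_fun_snd rec_fun_arg)
  then show ?thesis by (rule computable_by_code2[OF assms]) simp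
qed

text \<open>The recursion is simulated on codes: at every stage the numerical accumulator is the
  code of the abstract one. Counter, accumulator and parameter are packed into one code for the
  step.\<close>

lemma computable_rec_nat:
  assumes "computable e id N" "computable e e' F"
    and "computable (enc_prod id (enc_prod e' e)) e' (\<lambda>p. G (fst p) (fst (snd p)) (snd (snd p)))"
  shows "computable e e' (\<lambda>a. rec_nat (F a) (\<lambda>k r. G k r a) (N a))"
proof -
  obtain m where m: "rec_fun 1 m" "\<And>a. m [e a] = N a"
    using assms(1) unfolding computable_iff by auto
  obtain f where f: "rec_fun 1 f" "\<And>a. f [e a] = e' (F a)"
    using assms(2) unfolding computable_iff by blast
  obtain g where g: "rec_fun 1 g"
    "\<And>p. g [enc_prod id (enc_prod e' e) p] = e' (G (fst p) (fst (snd p)) (snd (snd p)))"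
    using assms(3) unfolding computable_iff by blast
  let ?g = "\<lambda>ys. g [prod_encode (ys ! 0, prod_encode (ys ! 1, ys ! 2))]"
  have "rec_fun (1 + 2) ?g"
    by (intro rec_fun_comp1[OF g(1)] rec_fun_prod_encode rec_fun_proj) auto
  from rec_fun_rec_nat[OF f(1) this m(1)]
  have "rec_fun 1 (\<lambda>xs. rec_nat (f xs) (\<lambda>k r. ?g (k # r # xs)) (m xs))" .
  moreover have "rec_nat (f [e a]) (\<lambda>k r. ?g (k # r # [e a])) n
      = e' (rec_nat (F a) (\<lambda>k r. G k r a) n)" for a n
  proof (induction n)
    case (Suc n)
    then show ?case
      using g(2)[of "(n, rec_nat (F a) (\<lambda>k r. G k r a) n, a)"] by (simp add: enc_prod_def)
  qed (simp add: f(2))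
  ultimately show ?thesis unfolding computable_iff using m(2) by auto
qed

lemmas computable_intros =
  computable_id computable_const computable_fst computable_snd computable_pair
  computable_if computable_Not computable_conj computable_disj

text \<open>A recursion with a single recursive call is unfolded along the orbit of the descent map:
  reading the orbit backwards from its end turns it into a primitive recursion, so that no
  coding of the history is needed.\<close>

lemma computable_linear_recursion:
  assumes B: "computable e of_bool B" and F: "computable e e' F"
    and G: "computable (enc_prod e e') e' (\<lambda>p. G (fst p) (snd p))"
    and d: "computable e e d" and m: "computable e id m"
    and less: "\<And>a. \<not> B a \<Longrightarrow> m (d a) < m a"
    and h: "\<And>a. h a = (if B a then F a else G a (h (d a)))"
  shows "computable e e' h"
proof -
  \<comment> \<open>Base points are made fixed points, so the orbit stays put once it reaches
    one.\<close>
  define step where "step a = (if B a then a else d a)" for a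
  define orbit where "orbit j a = rec_nat a (\<lambda>k. step) j" for j a
  \<comment> \<open>Stage \<open>k\<close> treats orbit position \<open>m a - Suc k\<close>, using
    the value \<open>r\<close> already found one position further along.\<close>
  define R where "R k r a = (if B (orbit (m a - Suc k) a) then F (orbit (m a - Suc k) a)
    else G (orbit (m a - Suc k) a) r)" for k r a
  have orbit_Suc: "orbit (Suc j) a = step (orbit j a)" for j a
    by (simp add: orbit_def)
  have stop: "B (orbit (m a) a)" for a
  proof -
    \<comment> \<open>Every move away from a non-base point lowers the measure by at least one.
      After \<open>m a\<close> moves the measure would be zero, leaving no room for another
      descent.\<close>
    have "B (orbit j a) \<or> m (orbit j a) + j \<le> m a" for j
    proof (induction j)
      case (Suc j)
      then show ?case using less[of "orbit j a"] by (auto simp: orbit_Suc step_def)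
    qed (simp add: orbit_def)
    from this[of "m a"] show ?thesis using less[of "orbit (m a) a"] by linarith
  qed
  \<comment> \<open>After \<open>k\<close> stages the accumulator holds \<open>h\<close> at position
    \<open>m a - k\<close>, so \<open>m a\<close> stages reach the starting point. At a base point
    the accumulator is replaced by the value of \<open>F\<close>.\<close>
  have rec: "rec_nat (F (orbit (m a) a)) (\<lambda>k r. R k r a) k = h (orbit (m a - k) a)"
    if "k \<le> m a" for a k
    using that
  proof (induction k)
    case 0
    then show ?case using h[of "orbit (m a) a"] stop by simp
  next
    case (Suc k)
    then have "m a - k = Suc (m a - Suc k)" by simp
    then have "orbit (m a - k) a = step (orbit (m a - Suc k) a)" by (metis orbit_Suc)
    then show ?case using Suc h[of "orbit (m a - Suc k) a"] by (simp add: R_def step_def)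
  qed
  have step_c: "computable e e step"
    unfolding step_def by (intro computable_if B d computable_id)
  have orbit_c: "computable (enc_prod id e) e (\<lambda>p. orbit (fst p) (snd p))"
    unfolding orbit_def
    by (rule computable_rec_nat[where G = "\<lambda>k r a. step r"])
      (rule computable_intros computable_comp[OF step_c])+
  let ?e3 = "enc_prod id (enc_prod e' e)"
  have b: "computable ?e3 e (\<lambda>p. orbit (m (snd (snd p)) - Suc (fst p)) (snd (snd p)))"
    by (rule computable_comp2[OF orbit_c] computable_diff computable_Suc computable_comp[OF m]
        computable_intros)+
  have "computable e e' (\<lambda>a. rec_nat (F (orbit (m a) a)) (\<lambda>k r. R k r a) (m a))"
  proof (rule computable_rec_nat[OF m])
    show "computable e e' (\<lambda>a. F (orbit (m a) a))"
      by (intro computable_comp[OF F] computable_comp2[OF orbit_c m] computable_id)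
    show "computable ?e3 e' (\<lambda>p. R (fst p) (fst (snd p)) (snd (snd p)))"
      unfolding R_def
      by (intro computable_if computable_comp[OF B b] computable_comp[OF F b]
          computable_comp2[OF G b] computable_fst[OF computable_snd[OF computable_id]])
  qed
  moreover have "rec_nat (F (orbit (m a) a)) (\<lambda>k r. R k r a) (m a) = h a" for a
    using rec[of "m a" a] by (simp add: orbit_def)
  ultimately show ?thesis by simp
qed


section \<open>Computability of constructors and destructors\<close>

lemma computable_list_eq_Nil:
  assumes "computable e (enc_list e1) F"
  shows "computable e of_bool (\<lambda>a. F a = [])"
proof (rule computable_eq_code_zero[OF assms])
  show "enc_list e1 b = 0 \<longleftrightarrow> b = []" for b by (cases b) (simp_all add: enc_list_def)
qed

lemma computable_hd:
  assumes "computable e (enc_list e1) F"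
  shows "computable e e1 (\<lambda>a. hd (F a))"
proof -
  \<comment> \<open>A nonempty list is coded by the successor of a pair, hence the predecessor. The
    value \<open>hd []\<close> is unspecified but fixed, so a constant covers the empty
    case.\<close>
  have "rec_fun 1 (\<lambda>xs. if xs ! 0 = 0 then e1 (hd []) else fst (prod_decode (xs ! 0 - 1)))"
    by (intro rec_fun_if_zero rec_fun_const rec_fun_fst rec_fun_pred rec_fun_arg)
  then show ?thesis
  proof (rule computable_by_code[OF assms])
    show "(if [enc_list e1 (F a)] ! 0 = 0 then e1 (hd [])
      else fst (prod_decode ([enc_list e1 (F a)] ! 0 - 1))) = e1 (hd (F a))" for a
      by (cases "F a") (simp_all add: enc_list_def)
  qed
qed

lemma computable_tl:
  assumes "computable e (enc_list e1) F"
  shows "computable e (enc_list e1) (\<lambda>a. tl (F a))"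
proof -
  have "rec_fun 1 (\<lambda>xs. if xs ! 0 = 0 then 0 else snd (prod_decode (xs ! 0 - 1)))"
    by (intro rec_fun_if_zero rec_fun_zero rec_fun_snd rec_fun_pred rec_fun_arg)
  then show ?thesis
  proof (rule computable_by_code[OF assms])
    show "(if [enc_list e1 (F a)] ! 0 = 0 then 0
      else snd (prod_decode ([enc_list e1 (F a)] ! 0 - 1))) = enc_list e1 (tl (F a))" for a
      by (cases "F a") (simp_all add: enc_list_def)
  qed
qed

text \<open>A pair code dominates its components and \<open>Cons\<close> adds a successor; this is
  the descent for recursions along lists.\<close>

lemma enc_list_tl_less: "xs \<noteq> [] \<Longrightarrow> enc_list e (tl xs) < enc_list e xs"
  by (cases xs) (simp_all add: enc_list_def less_Suc_eq_le le_prod_encode_2)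

section \<open>Options\<close>

lemma computable_Some:
  assumes "computable e e1 F"
  shows "computable e (enc_option e1) (\<lambda>a. Some (F a))"
  by (rule computable_by_code[OF assms rec_fun_Suc[OF rec_fun_arg]]) simp

lemma computable_option_eq_None:
  assumes "computable e (enc_option e1) F"
  shows "computable e of_bool (\<lambda>a. F a = None)"
proof (rule computable_eq_code_zero[OF assms])
  show "enc_option e1 b = 0 \<longleftrightarrow> b = None" for b by (cases b) simp_all
qed

lemma computable_the:
  assumes "computable e (enc_option e1) F"
  shows "computable e e1 (\<lambda>a. the (F a))"
proof -
  have "rec_fun 1 (\<lambda>xs. if xs ! 0 = 0 then e1 (the None) else xs ! 0 - 1)"
    by (intro rec_fun_if_zero rec_fun_const rec_fun_pred rec_fun_arg)
  then show ?thesis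
  proof (rule computable_by_code[OF assms])
    show "(if [enc_option e1 (F a)] ! 0 = 0 then e1 (the None)
      else [enc_option e1 (F a)] ! 0 - 1) = e1 (the (F a))" for a
      by (cases "F a") simp_all
  qed
qed

section \<open>Derivation trees\<close>

lemma sum_encode_Inl: "sum_encode (Inl x) = x + x"
  and sum_encode_Inr: "sum_encode (Inr x) = Suc (x + x)"
  by (simp_all add: sum_encode_def)

text \<open>Left summands have even codes and right summands odd ones, so doubling by addition, with
  a successor for the right, produces the tagged codes.\<close>

lemma computable_OB:
  assumes "computable e enc_cder F"
  shows "computable e enc_tder (\<lambda>a. OB (F a))"
  by (rule computable_by_code[OF assms rec_fun_add[OF rec_fun_arg rec_fun_arg]])
    (simp add: sum_encode_Inl)

lemma computable_AR:
  assumes "computable e enc_mder F" "computable e enc_mder G"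
  shows "computable e enc_tder (\<lambda>a. AR (F a) (G a))"
  by (rule computable_by_code2[OF assms rec_fun_Suc[OF rec_fun_add[OF rec_fun_arg rec_fun_arg]]])
    (simp add: sum_encode_Inr)

lemma computable_CC:
  assumes "computable e enc_cder F" "computable e enc_tder G"
  shows "computable e enc_cder (\<lambda>a. CC (F a) (G a))"
  by (rule computable_by_code2[OF assms rec_fun_Suc[OF rec_fun_arg]]) simp

lemma computable_VAR:
  assumes "computable e enc_cder F" "computable e id G"
  shows "computable e enc_mder (\<lambda>a. VAR (F a) (G a))"
  by (rule computable_by_code2[OF assms rec_fun_arg]) simp

lemma computable_ES:
  assumes "computable e enc_cder F"
  shows "computable e enc_sder (\<lambda>a. ES (F a))"
  by (rule computable_by_code[OF assms rec_fun_add[OF rec_fun_arg rec_fun_arg]])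
    (simp add: sum_encode_Inl)

lemma computable_SC:
  assumes "computable e enc_sder F" "computable e enc_cder G" "computable e enc_mder H"
  shows "computable e enc_sder (\<lambda>a. SC (F a) (G a) (H a))"
  by (rule computable_by_code2[OF assms(1) computable_pair[OF assms(2,3)]
        rec_fun_Suc[OF rec_fun_add[OF rec_fun_arg rec_fun_arg]]])
    (simp add: sum_encode_Inr enc_prod_def)

section \<open>Raw terms and types\<close>

primrec var_of :: "rtm \<Rightarrow> nat" where
  "var_of (Var x) = x"

lemma Var_var_of [simp]: "Var (var_of t) = t"
  by (cases t) simp

lemma computable_Var:
  assumes "computable e id F"
  shows "computable e enc_tm (\<lambda>a. Var (F a))"
  by (rule computable_by_code[OF assms rec_fun_arg]) simp

lemma enc_tm_eq: "enc_tm t = var_of t"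
  by (cases t) simp

lemma computable_var_of:
  assumes "computable e enc_tm F"
  shows "computable e id (\<lambda>a. var_of (F a))"
  by (rule computable_by_code[OF assms rec_fun_arg]) (simp add: enc_tm_eq)

text \<open>The destructors are made total by returning on \<open>Star\<close> the element with code
  zero, which matches the default zero of the functions on codes.\<close>

primrec arr_base :: "rty \<Rightarrow> rty" where
  "arr_base Star = Star"
| "arr_base (Arr A t u) = A"

primrec arr_src :: "rty \<Rightarrow> rtm" where
  "arr_src Star = Var 0"
| "arr_src (Arr A t u) = t"

primrec arr_tgt :: "rty \<Rightarrow> rtm" where
  "arr_tgt Star = Var 0"
| "arr_tgt (Arr A t u) = u"

lemma computable_Arr:
  assumes "computable e enc_ty F" "computable e enc_tm G" "computable e enc_tm H"
  shows "computable e enc_ty (\<lambda>a. Arr (F a) (G a) (H a))"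
  by (rule computable_by_code2[OF assms(1) computable_pair[OF assms(2,3)]
        rec_fun_Suc[OF rec_fun_arg]])
    (simp add: enc_prod_def)

lemma computable_ty_eq_Star:
  assumes "computable e enc_ty F"
  shows "computable e of_bool (\<lambda>a. F a = Star)"
proof (rule computable_eq_code_zero[OF assms])
  show "enc_ty b = 0 \<longleftrightarrow> b = Star" for b by (cases b) simp_all
qed

lemma computable_arr_base:
  assumes "computable e enc_ty F"
  shows "computable e enc_ty (\<lambda>a. arr_base (F a))"
proof -
  have "rec_fun 1 (\<lambda>xs. if xs ! 0 = 0 then 0 else fst (prod_decode (xs ! 0 - 1)))"
    by (intro rec_fun_if_zero rec_fun_zero rec_fun_fst rec_fun_pred rec_fun_arg)
  then show ?thesis
  proof (rule computable_by_code[OF assms])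
    show "(if [enc_ty (F a)] ! 0 = 0 then 0
      else fst (prod_decode ([enc_ty (F a)] ! 0 - 1))) = enc_ty (arr_base (F a))" for a
      by (cases "F a") simp_all
  qed
qed

lemma computable_arr_src:
  assumes "computable e enc_ty F"
  shows "computable e enc_tm (\<lambda>a. arr_src (F a))"
proof -
  have "rec_fun 1 (\<lambda>xs. if xs ! 0 = 0 then 0
      else fst (prod_decode (snd (prod_decode (xs ! 0 - 1)))))"
    by (intro rec_fun_if_zero rec_fun_zero rec_fun_fst rec_fun_snd rec_fun_pred rec_fun_arg)
  then show ?thesis
  proof (rule computable_by_code[OF assms])
    show "(if [enc_ty (F a)] ! 0 = 0 then 0
      else fst (prod_decode (snd (prod_decode ([enc_ty (F a)] ! 0 - 1)))))
      = enc_tm (arr_src (F a))" for a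
      by (cases "F a") simp_all
  qed
qed

lemma computable_arr_tgt:
  assumes "computable e enc_ty F"
  shows "computable e enc_tm (\<lambda>a. arr_tgt (F a))"
proof -
  have "rec_fun 1 (\<lambda>xs. if xs ! 0 = 0 then 0
      else snd (prod_decode (snd (prod_decode (xs ! 0 - 1)))))"
    by (intro rec_fun_if_zero rec_fun_zero rec_fun_snd rec_fun_pred rec_fun_arg)
  then show ?thesis
  proof (rule computable_by_code[OF assms])
    show "(if [enc_ty (F a)] ! 0 = 0 then 0
      else snd (prod_decode (snd (prod_decode ([enc_ty (F a)] ! 0 - 1)))))
      = enc_tm (arr_tgt (F a))" for a
      by (cases "F a") simp_all
  qed
qed

lemma enc_ty_arr_base_less: "A \<noteq> Star \<Longrightarrow> enc_ty (arr_base A) < enc_ty A"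
  by (cases A) (simp_all add: less_Suc_eq_le le_prod_encode_1)

lemmas computable_data =
  computable_list_eq_Nil computable_hd computable_tl
  computable_Some computable_option_eq_None computable_the
  computable_OB computable_AR computable_CC computable_VAR computable_ES computable_SC
  computable_Var computable_var_of
  computable_Arr computable_ty_eq_Star computable_arr_base computable_arr_src computable_arr_tgt


section \<open>Computability of substitution, lookup and length\<close>

lemma computable_length:
  assumes "computable e (enc_list e1) F"
  shows "computable e id (\<lambda>a. length (F a))"
proof -
  have "computable (enc_list e1) id length"
  \<comment> \<open>The code of the list is a computable bound on its length, which is itself still
    to be computed.\<close>
  proof (rule computable_linear_recursion[where d = tl and m = "enc_list e1"
        and B = "\<lambda>xs. xs = []" and F = "\<lambda>_. 0" and G = "\<lambda>_. Suc"])
    show "length xs = (if xs = [] then 0 else Suc (length (tl xs)))" for xs :: "'c list"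
      by (cases xs) simp_all
  qed (rule computable_intros computable_data computable_Suc computable_code enc_list_tl_less
      | assumption)+
  from computable_comp[OF this assms] show ?thesis .
qed

lemma computable_lookup:
  assumes "computable e id F" "computable e enc_sub G"
  shows "computable e enc_tm (\<lambda>a. lookup (F a) (G a))"
proof (rule computable_comp2[OF _ assms])
  show "computable (enc_prod id enc_sub) enc_tm (\<lambda>p. lookup (fst p) (snd p))"
    unfolding enc_sub_def
  \<comment> \<open>The descent stops at the first matching entry or at the empty list, and the
    value found there is passed back unchanged.\<close>
  proof (rule computable_linear_recursion[where d = "\<lambda>p. (fst p, tl (snd p))"
        and m = "\<lambda>p. enc_list (enc_prod id enc_tm) (snd p)"
        and B = "\<lambda>p. snd p = [] \<or> fst p = fst (hd (snd p))"
        and F = "\<lambda>p. if snd p = [] then Var (fst p) else snd (hd (snd p))"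
        and G = "\<lambda>p r. r"])
    show "lookup (fst p) (snd p) = (if snd p = [] \<or> fst p = fst (hd (snd p))
      then if snd p = [] then Var (fst p) else snd (hd (snd p))
      else lookup (fst (fst p, tl (snd p))) (snd (fst p, tl (snd p))))" for p
      by (cases "snd p") simp_all
  qed (rule computable_intros computable_data computable_eq_nat computable_code
      | simp add: enc_list_tl_less)+
qed

text \<open>Terms are variables, so substituting in the two end points is lookup and only the base
  type calls for recursion.\<close>

lemma computable_subst_ty:
  assumes "computable e enc_ty F" "computable e enc_sub G"
  shows "computable e enc_ty (\<lambda>a. subst_ty (F a) (G a))"
proof (rule computable_comp2[OF _ assms])
  show "computable (enc_prod enc_ty enc_sub) enc_ty (\<lambda>p. subst_ty (fst p) (snd p))"
  proof (rule computable_linear_recursion[where d = "\<lambda>p. (arr_base (fst p), snd p)"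
        and m = "\<lambda>p. enc_ty (fst p)" and B = "\<lambda>p. fst p = Star" and F = "\<lambda>p. Star"
        and G = "\<lambda>p r. Arr r (lookup (var_of (arr_src (fst p))) (snd p))
          (lookup (var_of (arr_tgt (fst p))) (snd p))"])
    have subst_tm: "subst_tm t \<gamma> = lookup (var_of t) \<gamma>" for t \<gamma>
      by (cases t) simp
    show "subst_ty (fst p) (snd p) = (if fst p = Star then Star
      else Arr (subst_ty (fst (arr_base (fst p), snd p)) (snd (arr_base (fst p), snd p)))
        (lookup (var_of (arr_src (fst p))) (snd p)) (lookup (var_of (arr_tgt (fst p))) (snd p)))" for p
      by (cases "fst p") (simp_all add: subst_tm)
  qed (rule computable_intros computable_data computable_lookup computable_code
      | simp add: enc_ty_arr_base_less)+
qed

text \<open>The position found is the one recorded by \<open>VAR\<close>, counted from the head as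
  in rule \<open>var\<close>. Tests against \<open>None\<close> and uses of \<open>the\<close>
  replace case distinctions because these are the operations shown computable.\<close>

fun index_of :: "'a \<Rightarrow> 'a list \<Rightarrow> nat option" where
  "index_of x [] = None"
| "index_of x (y # ys) =
    (if y = x then Some 0 else if index_of x ys = None then None
     else Some (Suc (the (index_of x ys))))"

lemma index_of_eq_None_iff: "index_of x xs = None \<longleftrightarrow> x \<notin> set xs"
  by (induction xs) auto

lemma nth_index_of:
  "x \<in> set xs \<Longrightarrow> the (index_of x xs) < length xs \<and> xs ! the (index_of x xs) = x"
  by (induction xs) (auto simp: index_of_eq_None_iff)

lemma computable_index_of:
  assumes "inj e1" "computable e e1 F" "computable e (enc_list e1) G"
  shows "computable e (enc_option id) (\<lambda>a. index_of (F a) (G a))"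
proof (rule computable_comp2[OF _ assms(2,3)])
  show "computable (enc_prod e1 (enc_list e1)) (enc_option id) (\<lambda>p. index_of (fst p) (snd p))"
  proof (rule computable_linear_recursion[where d = "\<lambda>p. (fst p, tl (snd p))"
        and m = "\<lambda>p. enc_list e1 (snd p)"
        and B = "\<lambda>p. snd p = [] \<or> hd (snd p) = fst p"
        and F = "\<lambda>p. if snd p = [] then None else Some 0"
        and G = "\<lambda>p r. if r = None then None else Some (Suc (the r))"])
    show "index_of (fst p) (snd p) = (if snd p = [] \<or> hd (snd p) = fst p
      then if snd p = [] then None else Some 0
      else if index_of (fst (fst p, tl (snd p))) (snd (fst p, tl (snd p))) = None then None
      else Some (Suc (the (index_of (fst (fst p, tl (snd p))) (snd (fst p, tl (snd p)))))))" for p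
      by (cases "snd p") auto
  qed (rule computable_intros computable_data computable_Suc computable_code
      computable_eq[OF _ _ assms(1)] | simp add: enc_list_tl_less)+
qed


section \<open>The type checkers\<close>

text \<open>The result \<open>r\<close> of checking \<open>\<Gamma>\<close> is a parameter of the checkers for types and terms,
  because a variable or \<open>Star\<close> derivation contains a derivation of its context. In this way
  only the checker for contexts is recursive.\<close>

definition check_tm_in :: "cder option \<Rightarrow> rctx \<Rightarrow> rty \<Rightarrow> rtm \<Rightarrow> mder option" where
  "check_tm_in r \<Gamma> A t =
    (if r = None \<or> index_of (var_of t, A) \<Gamma> = None then None
     else Some (VAR (the r) (the (index_of (var_of t, A) \<Gamma>))))"

definition check_ty_in :: "cder option \<Rightarrow> rctx \<Rightarrow> rty \<Rightarrow> tder option" where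
  "check_ty_in r \<Gamma> A =
    (if A = Star then if r = None then None else Some (OB (the r))
     else if check_tm_in r \<Gamma> (arr_base A) (arr_src A) = None
       \<or> check_tm_in r \<Gamma> (arr_base A) (arr_tgt A) = None then None
     else Some (AR (the (check_tm_in r \<Gamma> (arr_base A) (arr_src A)))
       (the (check_tm_in r \<Gamma> (arr_base A) (arr_tgt A)))))"

fun check_ctx :: "rctx \<Rightarrow> cder option" where
  "check_ctx [] = Some EC"
| "check_ctx (\<Gamma> \<lhd> p) =
    (if check_ctx \<Gamma> = None \<or> check_ty_in (check_ctx \<Gamma>) \<Gamma> (snd p) = None \<or> fst p \<noteq> length \<Gamma>
     then None
     else Some (CC (the (check_ctx \<Gamma>)) (the (check_ty_in (check_ctx \<Gamma>) \<Gamma> (snd p)))))"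

abbreviation check_ty :: "rctx \<Rightarrow> rty \<Rightarrow> tder option" where
  "check_ty \<Gamma> \<equiv> check_ty_in (check_ctx \<Gamma>) \<Gamma>"

abbreviation check_tm :: "rctx \<Rightarrow> rty \<Rightarrow> rtm \<Rightarrow> mder option" where
  "check_tm \<Gamma> \<equiv> check_tm_in (check_ctx \<Gamma>) \<Gamma>"

text \<open>The extended context is checked at every level because \<open>SC\<close> stores a
  derivation of it.\<close>

fun check_sub :: "rctx \<Rightarrow> rsub \<Rightarrow> rctx \<Rightarrow> sder option" where
  "check_sub \<Delta> [] [] = (if check_ctx \<Delta> = None then None else Some (ES (the (check_ctx \<Delta>))))"
| "check_sub \<Delta> (\<gamma> \<lhd> q) (\<Gamma> \<lhd> p) =
    (if fst p \<noteq> fst q \<or> check_sub \<Delta> \<gamma> \<Gamma> = None \<or> check_ctx (\<Gamma> \<lhd> p) = None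
       \<or> check_tm \<Delta> (subst_ty (snd p) \<gamma>) (snd q) = None then None
     else Some (SC (the (check_sub \<Delta> \<gamma> \<Gamma>)) (the (check_ctx (\<Gamma> \<lhd> p)))
       (the (check_tm \<Delta> (subst_ty (snd p) \<gamma>) (snd q)))))"
| "check_sub \<Delta> _ _ = None"


subsection \<open>Computability\<close>

lemma computable_check_tm_in:
  assumes "computable e (enc_option enc_cder) R" "computable e enc_ctx F"
    "computable e enc_ty G" "computable e enc_tm H"
  shows "computable e (enc_option enc_mder) (\<lambda>a. check_tm_in (R a) (F a) (G a) (H a))"
  unfolding check_tm_in_def
  by (rule assms assms(2)[unfolded enc_ctx_def] computable_intros computable_data
      computable_index_of[OF inj_enc_prod[OF inj_on_id inj_enc_ty]])+

lemma computable_check_ty_in: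
  assumes "computable e (enc_option enc_cder) R" "computable e enc_ctx F" "computable e enc_ty G"
  shows "computable e (enc_option enc_tder) (\<lambda>a. check_ty_in (R a) (F a) (G a))"
  unfolding check_ty_in_def
  by (rule assms computable_intros computable_data computable_check_tm_in)+

lemma computable_check_ctx:
  assumes "computable e enc_ctx F"
  shows "computable e (enc_option enc_cder) (\<lambda>a. check_ctx (F a))"
proof (rule computable_comp[OF _ assms])
  show "computable enc_ctx (enc_option enc_cder) check_ctx"
    unfolding enc_ctx_def
  \<comment> \<open>The result \<open>r\<close> for the tail serves as test, as subtree and as input
    of the type checker, so a single recursive call suffices.\<close>
  proof (rule computable_linear_recursion[where d = tl and m = "enc_list (enc_prod id enc_ty)"
        and B = "\<lambda>\<Gamma>. \<Gamma> = []" and F = "\<lambda>_. Some EC"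
        and G = "\<lambda>\<Gamma> r. if r = None \<or> check_ty_in r (tl \<Gamma>) (snd (hd \<Gamma>)) = None
            \<or> fst (hd \<Gamma>) \<noteq> length (tl \<Gamma>) then None
          else Some (CC (the r) (the (check_ty_in r (tl \<Gamma>) (snd (hd \<Gamma>)))))"])
    show "check_ctx \<Gamma> = (if \<Gamma> = [] then Some EC
      else if check_ctx (tl \<Gamma>) = None \<or> check_ty_in (check_ctx (tl \<Gamma>)) (tl \<Gamma>) (snd (hd \<Gamma>)) = None
        \<or> fst (hd \<Gamma>) \<noteq> length (tl \<Gamma>) then None
      else Some (CC (the (check_ctx (tl \<Gamma>)))
        (the (check_ty_in (check_ctx (tl \<Gamma>)) (tl \<Gamma>) (snd (hd \<Gamma>))))))" for \<Gamma>
      by (cases \<Gamma>) auto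
  qed (rule computable_intros computable_data computable_length computable_code computable_eq_nat
      computable_check_ty_in[unfolded enc_ctx_def] enc_list_tl_less | assumption)+
qed

lemma computable_check_sub:
  assumes "computable e enc_ctx F" "computable e enc_sub G" "computable e enc_ctx H"
  shows "computable e (enc_option enc_sder) (\<lambda>a. check_sub (F a) (G a) (H a))"
proof (rule computable_comp3[OF _ assms])
  \<comment> \<open>Here \<open>r\<close> is the result for the two tails. The context, substitution
    and term computations are already known to be computable and form no part of this
    recursion.\<close>
  define G where "G p r = (let \<Delta> = fst p; q = hd (fst (snd p)); \<gamma> = tl (fst (snd p)); \<Gamma> = snd (snd p)
      in if fst (hd \<Gamma>) \<noteq> fst q \<or> r = None \<or> check_ctx \<Gamma> = None
          \<or> check_tm \<Delta> (subst_ty (snd (hd \<Gamma>)) \<gamma>) (snd q) = None then None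
        else Some (SC (the r) (the (check_ctx \<Gamma>))
          (the (check_tm \<Delta> (subst_ty (snd (hd \<Gamma>)) \<gamma>) (snd q)))))"
    for p :: "rctx \<times> rsub \<times> rctx" and r
  show "computable (enc_prod enc_ctx (enc_prod enc_sub enc_ctx)) (enc_option enc_sder)
      (\<lambda>p. check_sub (fst p) (fst (snd p)) (snd (snd p)))"
    unfolding enc_ctx_def enc_sub_def
  \<comment> \<open>The descent ends as soon as either list is empty and succeeds only if both are
    and the ambient context is valid. The substitution loses an entry at each call, so its code is
    the measure.\<close>
  proof (rule computable_linear_recursion[where G = G
        and d = "\<lambda>p. (fst p, tl (fst (snd p)), tl (snd (snd p)))"
        and m = "\<lambda>p. enc_list (enc_prod id enc_tm) (fst (snd p))"
        and B = "\<lambda>p. fst (snd p) = [] \<or> snd (snd p) = []"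
        and F = "\<lambda>p. if fst (snd p) = [] \<and> snd (snd p) = [] \<and> check_ctx (fst p) \<noteq> None
          then Some (ES (the (check_ctx (fst p)))) else None"])
    show "check_sub (fst p) (fst (snd p)) (snd (snd p)) = (if fst (snd p) = [] \<or> snd (snd p) = []
      then if fst (snd p) = [] \<and> snd (snd p) = [] \<and> check_ctx (fst p) \<noteq> None
        then Some (ES (the (check_ctx (fst p)))) else None
      else G p (check_sub (fst (fst p, tl (fst (snd p)), tl (snd (snd p))))
        (fst (snd (fst p, tl (fst (snd p)), tl (snd (snd p)))))
        (snd (snd (fst p, tl (fst (snd p)), tl (snd (snd p)))))))" for p
      by (cases p; cases "fst (snd p)"; cases "snd (snd p)")
        (simp_all add: G_def Let_def del: check_ctx.simps(2))
  qed (unfold G_def Let_def, (rule computable_intros computable_data computable_code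
      computable_eq_nat computable_subst_ty[unfolded enc_sub_def]
      computable_check_ctx[unfolded enc_ctx_def] computable_check_tm_in[unfolded enc_ctx_def]
      | simp add: enc_list_tl_less)+)
qed


subsection \<open>Correctness\<close>

text \<open>The condition of \<open>decidable_family\<close> at one index, so that correctness can
  be stated for an arbitrary context result \<open>r\<close>.\<close>

definition decides :: "'d option \<Rightarrow> ('d \<Rightarrow> bool) \<Rightarrow> bool" where
  "decides r X \<longleftrightarrow> (case r of Some d \<Rightarrow> X d | None \<Rightarrow> \<not> (\<exists>d. X d))"

text \<open>Separates completeness from soundness in terms of \<open>None\<close> and
  \<open>the\<close>, the vocabulary of the checkers.\<close>

lemma decides_iff: "decides r X \<longleftrightarrow> (\<forall>d. X d \<longrightarrow> r \<noteq> None) \<and> (r \<noteq> None \<longrightarrow> X (the r))"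
  by (cases r) (auto simp: decides_def)

lemma check_tm_in_correct:
  assumes "decides r (ctx_der \<Gamma>)"
  shows "decides (check_tm_in r \<Gamma> A t) (tm_der \<Gamma> t A)"
proof -
  \<comment> \<open>A given derivation may point to another occurrence than the one found by
    \<open>index_of\<close>; it still witnesses membership, which makes the search succeed.\<close>
  have "check_tm_in r \<Gamma> A t \<noteq> None" if "tm_der \<Gamma> t A d" for d
    using that assms
    by cases (auto simp: check_tm_in_def decides_iff index_of_eq_None_iff in_set_conv_nth)
  moreover have "tm_der \<Gamma> t A (the (check_tm_in r \<Gamma> A t))" if "check_tm_in r \<Gamma> A t \<noteq> None"
  proof -
    have "ctx_der \<Gamma> (the r)" and "(var_of t, A) \<in> set \<Gamma>"
      using that assms by (auto simp: check_tm_in_def decides_iff index_of_eq_None_iff split: if_splits)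
    then have "tm_der \<Gamma> (Var (var_of t)) A (VAR (the r) (the (index_of (var_of t, A) \<Gamma>)))"
      using nth_index_of[of "(var_of t, A)" \<Gamma>] by (intro var) auto
    then show ?thesis using that by (auto simp: check_tm_in_def split: if_splits)
  qed
  ultimately show ?thesis by (auto simp: decides_iff)
qed

lemma check_ty_in_correct:
  assumes "decides r (ctx_der \<Gamma>)"
  shows "decides (check_ty_in r \<Gamma> A) (ty_der \<Gamma> A)"
proof (cases A)
  case Star
  then show ?thesis
    using assms by (auto simp: check_ty_in_def decides_iff intro: ob elim: ty_der.cases)
next
  case (Arr B t u)
  then show ?thesis
    using check_tm_in_correct[OF assms, of B t] check_tm_in_correct[OF assms, of B u]
    by (auto simp: check_ty_in_def decides_iff intro: ar elim: ty_der.cases)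
qed

text \<open>The induction hypothesis for the shorter context is exactly what the correctness of the
  type checker assumes about \<open>r\<close>; this resolves the mutual dependence of the
  judgements.\<close>

lemma check_ctx_correct: "decides (check_ctx \<Gamma>) (ctx_der \<Gamma>)"
proof (induction \<Gamma>)
  case Nil
  then show ?case by (auto simp: decides_iff intro: ec)
next
  case (Cons p \<Gamma>)
  obtain x A where p: "p = (x, A)" by fastforce
  from check_ty_in_correct[OF Cons.IH, of A] Cons.IH show ?case
    by (auto simp: p decides_iff intro: cc elim: ctx_der.cases)
qed

lemma check_sub_correct: "decides (check_sub \<Delta> \<gamma> \<Gamma>) (sub_der \<Delta> \<gamma> \<Gamma>)"
proof (induction \<Delta> \<gamma> \<Gamma> rule: check_sub.induct)
  case (1 \<Delta>)
  then show ?case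
    using check_ctx_correct[of \<Delta>] by (auto simp: decides_iff intro: es elim: sub_der.cases)
next
  case (2 \<Delta> q \<gamma> p \<Gamma>)
  obtain x A y t where pq: "p = (x, A)" "q = (y, t)" by fastforce
  have "decides (check_ctx (\<Gamma> \<lhd> p)) (ctx_der (\<Gamma> \<lhd> p))"
    "decides (check_tm \<Delta> (subst_ty A \<gamma>) t) (tm_der \<Delta> t (subst_ty A \<gamma>))"
    by (intro check_ctx_correct check_tm_in_correct)+
  \<comment> \<open>The recursive claim enters for equal variables; for distinct ones the checker
    returns \<open>None\<close> and \<open>sc\<close> cannot apply.\<close>
  moreover have "x = y \<Longrightarrow> decides (check_sub \<Delta> \<gamma> \<Gamma>) (sub_der \<Delta> \<gamma> \<Gamma>)"
    using 2 by (auto simp: pq)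
  ultimately show ?case
    by (auto simp: pq decides_iff simp del: check_ctx.simps intro: sc elim: sub_der.cases)
\<comment> \<open>In the remaining cases exactly one of the lists is empty, and no rule concludes
  such a judgement.\<close>
qed (auto simp: decides_iff elim: sub_der.cases)

lemma decidable_familyI:
  assumes "computable e (enc_option e') \<delta>" "\<And>i. decides (\<delta> i) (X i)"
  shows "decidable_family e e' X"
  using assms unfolding decidable_family_def decides_def by blast

theorem mainTheorem6:
  "decidable_family enc_ctx enc_cder ctx_der \<and>
   decidable_family (enc_prod enc_ctx (enc_prod enc_sub enc_ctx)) enc_sder
     (\<lambda>(\<Delta>, \<gamma>, \<Gamma>). sub_der \<Delta> \<gamma> \<Gamma>) \<and>
   decidable_family (enc_prod enc_ctx enc_ty) enc_tder
     (\<lambda>(\<Gamma>, A). ty_der \<Gamma> A) \<and>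
   decidable_family (enc_prod enc_ctx (enc_prod enc_ty enc_tm)) enc_mder
     (\<lambda>(\<Gamma>, A, t). tm_der \<Gamma> t A)"
proof (intro conjI)
  show "decidable_family enc_ctx enc_cder ctx_der"
    by (rule decidable_familyI[OF computable_check_ctx[OF computable_id] check_ctx_correct])
  have "decidable_family (enc_prod enc_ctx (enc_prod enc_sub enc_ctx)) enc_sder
     (\<lambda>i. sub_der (fst i) (fst (snd i)) (snd (snd i)))"
    by (rule decidable_familyI[OF _ check_sub_correct])
      (rule computable_check_sub computable_intros)+
  then show "decidable_family (enc_prod enc_ctx (enc_prod enc_sub enc_ctx)) enc_sder
     (\<lambda>(\<Delta>, \<gamma>, \<Gamma>). sub_der \<Delta> \<gamma> \<Gamma>)"
    by (simp add: case_prod_unfold)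
  have "decidable_family (enc_prod enc_ctx enc_ty) enc_tder (\<lambda>i. ty_der (fst i) (snd i))"
    by (rule decidable_familyI[OF _ check_ty_in_correct[OF check_ctx_correct]])
      (rule computable_check_ty_in computable_check_ctx computable_intros)+
  then show "decidable_family (enc_prod enc_ctx enc_ty) enc_tder (\<lambda>(\<Gamma>, A). ty_der \<Gamma> A)"
    by (simp add: case_prod_unfold)
  \<comment> \<open>The index triple lists the type before the term, whereas \<open>tm_der\<close>
    takes the term first; hence the order of projections.\<close>
  have "decidable_family (enc_prod enc_ctx (enc_prod enc_ty enc_tm)) enc_mder
     (\<lambda>i. tm_der (fst i) (snd (snd i)) (fst (snd i)))"
    by (rule decidable_familyI[OF _ check_tm_in_correct[OF check_ctx_correct]])
      (rule computable_check_tm_in computable_check_ctx computable_intros)+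
  then show "decidable_family (enc_prod enc_ctx (enc_prod enc_ty enc_tm)) enc_mder
     (\<lambda>(\<Gamma>, A, t). tm_der \<Gamma> t A)"
    by (simp add: case_prod_unfold)
qed

end
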